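(* Let $E,F$ be Banach spaces (both real or both complex), and let $U\subseteq E$ and $\Lambda\subseteq F$ be non-empty open sets. Let $f\colon\bar U\times\Lambda\to\bar U$ and assume that $f\in C^1(\bar U\times\Lambda,E)$, that is, $f$ is continuously differentiable on $\bar U\times\Lambda$ as a map into $E$. Assume further that there exists $L\in(0,1)$ such that $$\|f(x,\lambda)-f(y,\lambda)\|_E\leq L\|x-y\|_E$$ for all $x,y\in\bar U$ and all $\lambda\in\Lambda$. For every $\mu\in\Lambda$, let $x_\mu\in\bar U$ be the unique fixed point of $f(\cdot\,,\mu)$ (which exists by the Banach fixed point theorem). Then the map $\Lambda\to\bar U$, $\mu\mapsto x_\mu$, is continuously differentiable.
   Context: $\bar U$ is the closure of $U$ in $E$. $\mathcal L(X,Y)$ denotes the space of bounded linear operators from $X$ to $Y$ with the operator norm. Differentiability: for Banach spaces $X,Y$ and $W\subseteq X$ open, $g\colon W\to Y$ is differentiable at $x\in W$ if there exists a map $\Phi_x\colon W\to\mathcal L(X,Y)$, continuous at $x$, such that $g(y)=g(x)+\Phi_x(y)(y-x)$ for all $y\in W$; then $Dg(x):=\Phi_x(x)$ is the derivative (this is equivalent to Fréchet differentiability, with the same derivative). The map $g$ is continuously differentiable if it is differentiable at every point and $Dg$ is continuous as a map into $\mathcal L(X,Y)$. The map $\mu\mapsto x_\mu$ is regarded as a map from the open set $\Lambda\subseteq F$ into $E$. The hypothesis $f\in C^1(\bar U\times\Lambda,E)$ is stated without a further convention for differentiability at points of $\bar U\times\Lambda$ whose first component lies on the boundary of $U$. 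*)

theory Defs
  imports "HOL-Analysis.Analysis"
begin

(* Real and complex Banach spaces are treated uniformly. The class banach only carries the real
   structure; a Banach space over 'k is a type of class banach with a scalar multiplication s by 'k
   that extends scaleR and for which the norm is 'k-homogeneous. For 'k = real this forces
   s = scaleR; for 'k = complex it is a complex Banach space. Up to isometric isomorphism, these are
   the only instances of real_normed_field (Gelfand-Mazur). *)

locale banach_space_over = vector_space s
  for s :: "'k::real_normed_field \<Rightarrow> 'a::banach \<Rightarrow> 'a" +
  assumes scale_of_real: "s (of_real r) x = r *\<^sub>R x"
    and norm_scale: "norm (s c x) = norm c * norm x"

(* The norm of the space of bounded 'k-linear operators is the restriction of the norm of the
   type of bounded real-linear operators, so D below is a continuous map into that space.

   W need not be open. At a point p of W that is not interior, the derivative is taken along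
   points of W only; such a derivative need not be unique, and the definition asks for a choice
   D p that is continuous on all of W. If W is contained in the closure of its interior, then D is
   nevertheless unique; for open W this is the usual notion. *)

definition continuously_differentiable_on ::
  "('k::real_normed_field \<Rightarrow> 'a \<Rightarrow> 'a) \<Rightarrow> ('k \<Rightarrow> 'b \<Rightarrow> 'b) \<Rightarrow>
    'a set \<Rightarrow> ('a::banach \<Rightarrow> 'b::banach) \<Rightarrow> bool" where
  "continuously_differentiable_on sX sY W g \<longleftrightarrow>
    (\<exists>D :: 'a \<Rightarrow> 'a \<Rightarrow>\<^sub>L 'b.
      (\<forall>p\<in>W. Vector_Spaces.linear sX sY (blinfun_apply (D p)) \<and>
             (g has_derivative blinfun_apply (D p)) (at p within W)) \<and>
      continuous_on W D)"

end

theory Submission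
  imports Defs
begin

text \<open>
  Existence and uniqueness of the fixed point \<open>x \<mu>\<close> is the Banach fixed point theorem on the
  complete set \<open>closure U\<close>. For differentiability, let \<open>D\<close> be the derivative of \<open>f\<close> at
  \<open>(x \<mu>, \<mu>)\<close>. Formally differentiating \<open>f (x \<mu>, \<mu>) = x \<mu>\<close> in direction \<open>h\<close> shows that the
  derivative \<open>T h\<close> of \<open>x\<close> should satisfy \<open>D (T h, h) = T h\<close>: it should be the fixed point of the
  linearized map \<open>y \<mapsto> D (y, h)\<close>.

  This linearized map is again a contraction with constant \<open>L\<close>, that is, the partial derivative
  \<open>v \<mapsto> D (v, 0)\<close> has norm at most \<open>L\<close>. At points of \<open>U\<close> this is the usual estimate for the
  derivative of a Lipschitz map. The fixed point may however lie on the boundary of \<open>U\<close>, where only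
  some directions are accessible from within \<open>closure U\<close>; there the bound follows from the one on
  \<open>U\<close> by continuity of the derivative (\<open>partial_derivative_contraction\<close>). Hence \<open>T h\<close> exists, and
  it depends linearly and boundedly on \<open>h\<close> (\<open>fixed_point_operator_exists\<close>).

  Everything else follows from one stability estimate (\<open>linear_fixed_point_stability\<close>): any \<open>y\<close>
  satisfies \<open>norm (y - T h) \<le> norm (y - D (y, h)) / (1 - L)\<close>. An approximate solution of
  the linearized equation is therefore close to \<open>T h\<close>. With \<open>y = x (\<mu> + h) - x \<mu>\<close> the
  right-hand side is, up to the factor \<open>1 / (1 - L)\<close>, the error of the first-order expansion of \<open>f\<close>
  between two points of \<open>closure U \<times> \<Lambda>\<close>, so a derivative within that set suffices, and
  \<open>T\<close> is the derivative of \<open>x\<close> (\<open>fixed_point_has_derivative\<close>). With \<open>y = T' h\<close> for the operator \<open>T'\<close>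
  at another parameter, it yields continuity of the derivative
  (\<open>fixed_point_operator_stability\<close>). With \<open>y = c T(h)\<close> for a scalar \<open>c\<close>, compared with \<open>T (c h)\<close>,
  it yields linearity over the ground field (\<open>fixed_point_operator_linear\<close>).
\<close>

section \<open>Fixed points of the linearized contraction\<close>

text \<open>
  Think of \<open>v - w\<close> as the image of \<open>v\<close> under a contraction that fixes \<open>0\<close>. Its norm is at most the
  fraction \<open>L\<close> of the norm of \<open>v\<close>, so \<open>w\<close> must account for the remaining fraction \<open>1 - L\<close>.
\<close>

lemma contraction_defect_bound:
  fixes v w :: "'a::real_normed_vector"
  assumes "L < 1" and "norm (v - w) \<le> L * norm v"
  shows "norm v \<le> norm w / (1 - L)"
proof -
  have "norm v \<le> norm (v - w) + norm w"
    by (metis diff_add_cancel norm_triangle_ineq)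
  then have "norm v * (1 - L) \<le> norm w"
    using assms(2) by (simp add: algebra_simps)
  then show ?thesis
    using assms(1) by (simp add: pos_le_divide_eq)
qed

text \<open>
  The maps \<open>y \<mapsto> D (y, h)\<close> differ from the single contraction \<open>v \<mapsto> D (v, 0)\<close> only by constants.
  Hence \<open>y - z\<close> is reproduced by it up to the defect \<open>y - D (y, h)\<close>. For \<open>D (y, h) = y\<close> the
  estimate says that the fixed point is unique.
\<close>

lemma linear_fixed_point_stability:
  fixes D :: "('a::real_normed_vector \<times> 'b::real_normed_vector) \<Rightarrow>\<^sub>L 'a"
  assumes "L < 1" and D: "\<And>v. norm (D (v, 0)) \<le> L * norm v"
    and fixed: "D (z, h) = z"
  shows "norm (y - z) \<le> norm (y - D (y, h)) / (1 - L)"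
proof (rule contraction_defect_bound[OF assms(1)])
  have "D (y, h) - D (z, h) = D (y - z, 0)"
    by (simp flip: blinfun.diff_right)
  then have "(y - z) - (y - D (y, h)) = D (y - z, 0)"
    using fixed by (simp add: algebra_simps)
  then show "norm ((y - z) - (y - D (y, h))) \<le> L * norm (y - z)"
    using D by simp
qed

text \<open>
  Writing \<open>A v = D (v, 0)\<close> and \<open>B h = D (0, h)\<close>, the operator obtained here is \<open>B\<close> followed by
  the inverse of \<open>I - A\<close>. Solving the equation by the contraction principle replaces the
  Neumann series, and uniqueness of its solutions gives additivity and homogeneity.
\<close>

lemma fixed_point_operator_exists:
  fixes D :: "('a::banach \<times> 'b::real_normed_vector) \<Rightarrow>\<^sub>L 'a"
  assumes "0 \<le> L" and "L < 1" and D: "\<And>v. norm (D (v, 0)) \<le> L * norm v"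
  obtains T :: "'b \<Rightarrow>\<^sub>L 'a" where "\<And>h. D (T h, h) = T h"
proof -
  note stab = linear_fixed_point_stability[OF assms(2) D]
  have "\<exists>y. D (y, h) = y" for h
  proof -
    have "\<exists>!y\<in>UNIV. D (y, h) = y"
    proof (rule Banach_fix[OF _ _ assms(1,2)])
      fix y z
      have "D (y, h) - D (z, h) = D (y - z, 0)"
        by (simp flip: blinfun.diff_right)
      then show "dist (D (y, h)) (D (z, h)) \<le> L * dist y z"
        using D by (simp add: dist_norm)
    qed (auto simp: complete_UNIV)
    then show ?thesis by auto
  qed
  then obtain t where t: "\<And>h. D (t h, h) = t h" by metis
  have uniq: "y = t h" if "D (y, h) = y" for y h
    using stab[OF t, of y h] that by simp
  have "bounded_linear t"
  proof (rule bounded_linear_intro)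
    fix h k
    have "D (t h + t k, h + k) = t h + t k"
      using t by (metis add_Pair blinfun.add_right)
    then show "t (h + k) = t h + t k" using uniq by metis
  next
    fix r h
    have "D (r *\<^sub>R t h, r *\<^sub>R h) = r *\<^sub>R t h"
      using t by (metis scaleR_Pair blinfun.scaleR_right)
    then show "t (r *\<^sub>R h) = r *\<^sub>R t h" using uniq by metis
  next
    fix h
    \<comment> \<open>The estimate for the approximate solution \<open>y = 0\<close>, whose defect is \<open>- D (0, h)\<close>.\<close>
    have "norm (t h) \<le> norm (D (0, h)) / (1 - L)"
      using stab[OF t, of 0 h] by simp
    also have "\<dots> \<le> norm D * norm h / (1 - L)"
      using norm_blinfun[of D "(0, h)"] assms(2)
      by (intro divide_right_mono) (auto simp: norm_Pair)
    finally show "norm (t h) \<le> norm h * (norm D / (1 - L))"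
      by (simp add: mult.commute)
  qed
  then show thesis
    using t that[of "Blinfun t"] by (simp add: bounded_linear_Blinfun_apply)
qed

text \<open>
  The value \<open>T' h\<close> solves the equation for \<open>D'\<close>, so it solves the one for \<open>D\<close> up to the defect
  \<open>(D' - D) (T' h, h)\<close>. The bound involves the norm of \<open>T'\<close> only, so that for fixed \<open>T'\<close> it tends
  to zero as \<open>D\<close> tends to \<open>D'\<close>, without prior control of \<open>T\<close>.
\<close>

lemma fixed_point_operator_stability:
  fixes D D' :: "('a::real_normed_vector \<times> 'b::real_normed_vector) \<Rightarrow>\<^sub>L 'a"
    and T T' :: "'b \<Rightarrow>\<^sub>L 'a"
  assumes "L < 1" and D: "\<And>v. norm (D (v, 0)) \<le> L * norm v"
    and T: "\<And>h. D (T h, h) = blinfun_apply T h"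
    and T': "\<And>h. D' (T' h, h) = blinfun_apply T' h"
  shows "norm (T - T') \<le> (norm T' + 1) / (1 - L) * norm (D - D')"
proof (rule norm_blinfun_bound)
  fix h
  have "norm (T' h - T h) \<le> norm (T' h - D (T' h, h)) / (1 - L)"
    by (rule linear_fixed_point_stability[OF assms(1) D T])
  also have "T' h - D (T' h, h) = (D' - D) (T' h, h)"
    by (simp add: T' blinfun.diff_left)
  also have "norm \<dots> \<le> norm (D' - D) * ((norm T' + 1) * norm h)"
  proof (rule order_trans[OF norm_blinfun mult_left_mono])
    show "norm (T' h, h) \<le> (norm T' + 1) * norm h"
      using norm_Pair_le[of "T' h" h] norm_blinfun[of T' h] by (simp add: algebra_simps)
  qed simp
  finally show "norm ((T - T') h) \<le> (norm T' + 1) / (1 - L) * norm (D - D') * norm h"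
    using assms(1)
    by (simp add: divide_right_mono blinfun.diff_left norm_minus_commute mult_ac)
qed (use assms(1) in simp)

text \<open>
  If \<open>D\<close> respects the scalars, then multiplying \<open>D (T h, h) = T h\<close> by a scalar \<open>c\<close> shows that
  \<open>c T(h)\<close> solves the equation that characterizes \<open>T (c h)\<close>.
\<close>

lemma fixed_point_operator_linear:
  fixes D :: "('e::banach \<times> 'f::banach) \<Rightarrow>\<^sub>L 'e"
    and T :: "'f \<Rightarrow>\<^sub>L 'e"
  assumes "banach_space_over sE" and "banach_space_over sF"
    and lin: "Vector_Spaces.linear (module_prod.scale sE sF) sE (blinfun_apply D)"
    and "L < 1" and D: "\<And>v. norm (D (v, 0)) \<le> L * norm v"
    and T: "\<And>h. D (T h, h) = blinfun_apply T h"
  shows "Vector_Spaces.linear sF sE (blinfun_apply T)"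
proof -
  interpret E: banach_space_over sE by fact
  interpret F: banach_space_over sF by fact
  interpret P: module_prod sE sF ..
  interpret D: Vector_Spaces.linear "module_prod.scale sE sF" sE "blinfun_apply D" by fact
  have "T (sF c h) = sE c (T h)" for c h
  proof -
    have "D (sE c (T h), sF c h) = sE c (T h)"
      using D.scale[of c "(T h, h)"] by (simp add: P.scale_def T)
    then show ?thesis
      using linear_fixed_point_stability[OF assms(4) D T, of "sE c (T h)" "sF c h"] by simp
  qed
  then show ?thesis
    by unfold_locales (auto simp: blinfun.add_right)
qed

section \<open>The partial derivative is a contraction\<close>

text \<open>
  By homogeneity it suffices to bound \<open>D\<close> on a small multiple of \<open>v\<close>, where it is an increment of
  \<open>g\<close> up to a small error. Since \<open>S\<close> is open, this multiple leads to a point of \<open>S\<close>.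
\<close>

lemma Lipschitz_has_derivative_norm_le:
  fixes g :: "'a::real_normed_vector \<Rightarrow> 'b::real_normed_vector"
  assumes deriv: "(g has_derivative D) (at a)" and "open S" and "a \<in> S"
    and lip: "\<And>y. y \<in> S \<Longrightarrow> norm (g y - g a) \<le> L * norm (y - a)"
  shows "norm (D v) \<le> L * norm v"
proof -
  have lin: "linear D"
    using has_derivative_linear[OF deriv] .
  show ?thesis
  proof (cases "v = 0")
    case False
    show ?thesis
    proof (rule field_le_epsilon)
      fix e :: real assume "0 < e"
      define e' where "e' = e / norm v"
      have "0 < e'" using \<open>0 < e\<close> False by (simp add: e'_def)
      then obtain d where "0 < d" and d: "\<And>y. norm (y - a) < d \<Longrightarrow>
          norm (g y - g a - D (y - a)) \<le> e' * norm (y - a)"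
        using deriv unfolding has_derivative_at_alt by blast
      obtain r where "0 < r" and r: "ball a r \<subseteq> S"
        using assms(2,3) openE by blast
      define t where "t = min d r / (2 * norm v)"
      have "0 < t" using \<open>0 < d\<close> \<open>0 < r\<close> False by (simp add: t_def)
      have small: "norm (t *\<^sub>R v) < d" "norm (t *\<^sub>R v) < r"
        using \<open>0 < d\<close> \<open>0 < r\<close> False by (auto simp: t_def)
      have "norm (D (t *\<^sub>R v)) \<le> norm (g (a + t *\<^sub>R v) - g a) +
          norm (g (a + t *\<^sub>R v) - g a - D (t *\<^sub>R v))"
        by (metis norm_triangle_sub norm_minus_commute)
      also have "\<dots> \<le> L * norm (t *\<^sub>R v) + e' * norm (t *\<^sub>R v)"
        using d[of "a + t *\<^sub>R v"] lip[of "a + t *\<^sub>R v"] small r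
        by (intro add_mono) (auto simp: dist_norm subset_eq)
      finally have "t * norm (D v) \<le> t * (L * norm v + e' * norm v)"
        using \<open>0 < t\<close> by (simp add: linear_scale[OF lin] algebra_simps)
      then show "norm (D v) \<le> L * norm v + e"
        using \<open>0 < t\<close> False by (simp add: e'_def)
    qed
  qed (simp add: linear_0[OF lin])
qed

text \<open>
  The derivative of \<open>f\<close> within \<open>closure U \<times> \<Lambda>\<close> restricts, along the slice with parameter \<open>\<mu>\<close>,
  to a two-sided derivative at each point of \<open>U\<close>, and the Lipschitz bound passes to it. The bound
  extends to boundary points as a closed condition on the continuous function \<open>D\<close>.
\<close>

lemma partial_derivative_contraction:
  fixes f :: "'a::real_normed_vector \<times> 'b::real_normed_vector \<Rightarrow> 'c::real_normed_vector"
    and D :: "'a \<times> 'b \<Rightarrow> ('a \<times> 'b) \<Rightarrow>\<^sub>L 'c"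
  assumes "open U" and \<mu>: "\<mu> \<in> \<Lambda>"
    and deriv: "\<And>p. p \<in> closure U \<times> \<Lambda> \<Longrightarrow>
      (f has_derivative D p) (at p within closure U \<times> \<Lambda>)"
    and cont: "continuous_on (closure U \<times> \<Lambda>) D"
    and lip: "\<And>x y. x \<in> closure U \<Longrightarrow> y \<in> closure U \<Longrightarrow>
      norm (f (x, \<mu>) - f (y, \<mu>)) \<le> L * norm (x - y)"
    and x: "x \<in> closure U"
  shows "norm (D (x, \<mu>) (v, 0)) \<le> L * norm v"
proof -
  have "norm (D (a, \<mu>) (v, 0)) \<le> L * norm v" if "a \<in> U" for a
  proof -
    have cl: "U \<subseteq> closure U" by (rule closure_subset)
    have emb: "((\<lambda>y. (y, \<mu>)) has_derivative (\<lambda>v. (v, 0))) (at a within U)"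
      by (auto intro!: derivative_eq_intros)
    have img: "(\<lambda>y. (y, \<mu>)) ` U \<subseteq> closure U \<times> \<Lambda>"
      using cl \<mu> by auto
    have "((\<lambda>y. f (y, \<mu>)) has_derivative (\<lambda>v. D (a, \<mu>) (v, 0))) (at a within U)"
      using has_derivative_in_compose[OF emb has_derivative_subset[OF deriv img]] cl that \<mu>
      by auto
    then have "((\<lambda>y. f (y, \<mu>)) has_derivative (\<lambda>v. D (a, \<mu>) (v, 0))) (at a)"
      using at_within_open[OF that \<open>open U\<close>] by simp
    then show ?thesis
      by (rule Lipschitz_has_derivative_norm_le[OF _ \<open>open U\<close> that])
        (use lip cl that in blast)
  qed
  moreover have "continuous_on (closure U) (\<lambda>a. D (a, \<mu>) (v, 0))"
    by (intro continuous_intros continuous_on_compose2[OF cont]) (use \<mu> in auto)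
  ultimately show ?thesis
    using continuous_on_closure_norm_le x by blast
qed

section \<open>Differentiability of the fixed point\<close>

text \<open>
  With \<open>y = x \<nu> - x \<mu>\<close> and \<open>h = \<nu> - \<mu>\<close>, differentiability of \<open>f\<close> makes the defect \<open>y - D (y, h)\<close>
  small compared with \<open>norm (y, h)\<close>. To compare it with \<open>norm h\<close> alone one first needs
  \<open>y\<close> to be of the order of \<open>h\<close>. This local Lipschitz bound for \<open>x\<close> at \<open>\<mu>\<close> uses
  the contraction property of \<open>f\<close> and the first-order expansion of \<open>\<nu> \<mapsto> f (x \<mu>, \<nu>)\<close>.
\<close>

lemma fixed_point_has_derivative:
  fixes f :: "'a::real_normed_vector \<times> 'b::real_normed_vector \<Rightarrow> 'a"
    and D :: "('a \<times> 'b) \<Rightarrow>\<^sub>L 'a"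
    and T :: "'b \<Rightarrow>\<^sub>L 'a"
  assumes "L < 1" and \<mu>: "\<mu> \<in> \<Lambda>"
    and x: "\<And>\<nu>. \<nu> \<in> \<Lambda> \<Longrightarrow> x \<nu> \<in> X \<and> f (x \<nu>, \<nu>) = x \<nu>"
    and lip: "\<And>y z \<nu>. y \<in> X \<Longrightarrow> z \<in> X \<Longrightarrow> \<nu> \<in> \<Lambda> \<Longrightarrow>
      norm (f (y, \<nu>) - f (z, \<nu>)) \<le> L * norm (y - z)"
    and deriv: "(f has_derivative D) (at (x \<mu>, \<mu>) within X \<times> \<Lambda>)"
    and D: "\<And>v. norm (D (v, 0)) \<le> L * norm v"
    and T: "\<And>h. D (T h, h) = blinfun_apply T h"
  shows "(x has_derivative T) (at \<mu> within \<Lambda>)"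
proof -
  have approx: "\<exists>d>0. \<forall>y\<in>X. \<forall>\<nu>\<in>\<Lambda>. norm (y - x \<mu>, \<nu> - \<mu>) < d \<longrightarrow>
      norm (f (y, \<nu>) - x \<mu> - D (y - x \<mu>, \<nu> - \<mu>)) \<le> e * norm (y - x \<mu>, \<nu> - \<mu>)"
    if "0 < e" for e
    using deriv that x[OF \<mu>] unfolding has_derivative_within_alt by force
  \<comment> \<open>The expansion of \<open>f\<close> with error factor \<open>1\<close> bounds the change of \<open>f (x \<mu>, \<cdot>)\<close> by
    \<open>(norm D + 1) * norm (\<nu> - \<mu>)\<close>; the defect bound contributes the denominator.\<close>
  define K where "K = (1 + norm D) / (1 - L)"
  have "0 < 1 - L" using assms(1) by simp
  then have "0 < K" by (simp add: K_def add_pos_nonneg)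
  obtain d where "0 < d" and Lip: "\<And>\<nu>. \<nu> \<in> \<Lambda> \<Longrightarrow> norm (\<nu> - \<mu>) < d \<Longrightarrow>
      norm (x \<nu> - x \<mu>) \<le> K * norm (\<nu> - \<mu>)"
  proof -
    obtain d where "0 < d" and d: "\<And>y \<nu>. y \<in> X \<Longrightarrow> \<nu> \<in> \<Lambda> \<Longrightarrow>
        norm (y - x \<mu>, \<nu> - \<mu>) < d \<Longrightarrow>
        norm (f (y, \<nu>) - x \<mu> - D (y - x \<mu>, \<nu> - \<mu>)) \<le> norm (y - x \<mu>, \<nu> - \<mu>)"
      using approx[of 1] by auto
    show thesis
    proof (rule that[OF \<open>0 < d\<close>])
      fix \<nu> assume \<nu>: "\<nu> \<in> \<Lambda>" "norm (\<nu> - \<mu>) < d"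
      let ?w = "f (x \<mu>, \<nu>) - x \<mu>"
      have "norm (x \<nu> - x \<mu> - ?w) \<le> L * norm (x \<nu> - x \<mu>)"
        using lip[of "x \<nu>" "x \<mu>" \<nu>] x[OF \<mu>] x[OF \<nu>(1)] \<nu>(1) by simp
      then have "norm (x \<nu> - x \<mu>) \<le> norm ?w / (1 - L)"
        by (rule contraction_defect_bound[OF assms(1)])
      also have "norm ?w \<le> norm (D (0, \<nu> - \<mu>)) + norm (?w - D (0, \<nu> - \<mu>))"
        by (metis norm_triangle_sub)
      also have "\<dots> \<le> norm D * norm (\<nu> - \<mu>) + norm (\<nu> - \<mu>)"
        using d[of "x \<mu>" \<nu>] x[OF \<mu>] \<nu> norm_blinfun[of D "(0, \<nu> - \<mu>)"]
        by (intro add_mono) (auto simp: norm_Pair)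
      finally show "norm (x \<nu> - x \<mu>) \<le> K * norm (\<nu> - \<mu>)"
        using \<open>0 < 1 - L\<close> by (simp add: K_def divide_right_mono algebra_simps)
    qed
  qed
  show ?thesis
    unfolding has_derivative_within_alt
  proof (intro conjI allI impI)
    fix e :: real assume "0 < e"
    \<comment> \<open>The factor \<open>K + 1\<close> compares \<open>norm (y, h)\<close> with \<open>norm h\<close>, and stability costs \<open>1 / (1 - L)\<close>.\<close>
    define e' where "e' = e * (1 - L) / (K + 1)"
    have "0 < e'" using \<open>0 < e\<close> \<open>0 < 1 - L\<close> \<open>0 < K\<close> by (simp add: e'_def)
    then obtain r where "0 < r" and r: "\<And>y \<nu>. y \<in> X \<Longrightarrow> \<nu> \<in> \<Lambda> \<Longrightarrow>
        norm (y - x \<mu>, \<nu> - \<mu>) < r \<Longrightarrow>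
        norm (f (y, \<nu>) - x \<mu> - D (y - x \<mu>, \<nu> - \<mu>)) \<le> e' * norm (y - x \<mu>, \<nu> - \<mu>)"
      using approx[of e'] by auto
    show "\<exists>d>0. \<forall>\<nu>\<in>\<Lambda>. norm (\<nu> - \<mu>) < d \<longrightarrow>
        norm (x \<nu> - x \<mu> - T (\<nu> - \<mu>)) \<le> e * norm (\<nu> - \<mu>)"
    proof (intro exI[of _ "min d (r / (K + 1))"] conjI ballI impI)
      show "0 < min d (r / (K + 1))"
        using \<open>0 < d\<close> \<open>0 < r\<close> \<open>0 < K\<close> by simp
    next
      fix \<nu> assume \<nu>: "\<nu> \<in> \<Lambda>" and "norm (\<nu> - \<mu>) < min d (r / (K + 1))"
      then have small: "norm (\<nu> - \<mu>) < d" "(K + 1) * norm (\<nu> - \<mu>) < r"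
        using \<open>0 < K\<close> by (auto simp: pos_less_divide_eq mult.commute)
      let ?q = "(x \<nu> - x \<mu>, \<nu> - \<mu>)"
      have q: "norm ?q \<le> (K + 1) * norm (\<nu> - \<mu>)"
        using norm_Pair_le[of "x \<nu> - x \<mu>" "\<nu> - \<mu>"] Lip[OF \<nu> small(1)]
        by (simp add: algebra_simps)
      have "norm (x \<nu> - x \<mu> - T (\<nu> - \<mu>)) \<le> norm (x \<nu> - x \<mu> - D ?q) / (1 - L)"
        by (rule linear_fixed_point_stability[OF assms(1) D T])
      also have "norm (x \<nu> - x \<mu> - D ?q) \<le> e' * norm ?q"
        using r[of "x \<nu>" \<nu>] x[OF \<nu>] \<nu> q small(2) by simp
      also have "\<dots> \<le> e' * ((K + 1) * norm (\<nu> - \<mu>))"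
        using q \<open>0 < e'\<close> by (intro mult_left_mono) auto
      also have "\<dots> = e * norm (\<nu> - \<mu>) * (1 - L)"
        using \<open>0 < K\<close> by (simp add: e'_def)
      finally show "norm (x \<nu> - x \<mu> - T (\<nu> - \<mu>)) \<le> e * norm (\<nu> - \<mu>)"
        using \<open>0 < 1 - L\<close> by (simp add: divide_right_mono)
    qed
  qed (rule blinfun.bounded_linear_right)
qed

theorem theorem7p2:
  fixes sE :: "'k::real_normed_field \<Rightarrow> 'e::banach \<Rightarrow> 'e"
    and sF :: "'k \<Rightarrow> 'f::banach \<Rightarrow> 'f"
    and U :: "'e set" and \<Lambda> :: "'f set"
    and f :: "'e \<times> 'f \<Rightarrow> 'e"
    and L :: real
  assumes "banach_space_over sE" and "banach_space_over sF"
    and "open U" and "U \<noteq> {}" and "open \<Lambda>" and "\<Lambda> \<noteq> {}"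
    and "f \<in> closure U \<times> \<Lambda> \<rightarrow> closure U"
    and "continuously_differentiable_on (module_prod.scale sE sF) sE (closure U \<times> \<Lambda>) f"
    and "0 < L" and "L < 1"
    and "\<And>x y \<mu>. x \<in> closure U \<Longrightarrow> y \<in> closure U \<Longrightarrow> \<mu> \<in> \<Lambda> \<Longrightarrow>
           norm (f (x, \<mu>) - f (y, \<mu>)) \<le> L * norm (x - y)"
  shows "(\<forall>\<mu>\<in>\<Lambda>. \<exists>!x. x \<in> closure U \<and> f (x, \<mu>) = x) \<and>
    continuously_differentiable_on sF sE \<Lambda> (\<lambda>\<mu>. THE x. x \<in> closure U \<and> f (x, \<mu>) = x)"
proof
  show ex1: "\<forall>\<mu>\<in>\<Lambda>. \<exists>!x. x \<in> closure U \<and> f (x, \<mu>) = x"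
  proof
    fix \<mu> assume "\<mu> \<in> \<Lambda>"
    then have "\<exists>!x\<in>closure U. f (x, \<mu>) = x"
      using assms(4,7,9-11)
      by (intro Banach_fix[where c = L]) (auto simp: complete_eq_closed dist_norm Pi_iff)
    then show "\<exists>!x. x \<in> closure U \<and> f (x, \<mu>) = x" .
  qed
  define x where "x = (\<lambda>\<mu>. THE x. x \<in> closure U \<and> f (x, \<mu>) = x)"
  have x: "x \<mu> \<in> closure U \<and> f (x \<mu>, \<mu>) = x \<mu>" if "\<mu> \<in> \<Lambda>" for \<mu>
    using ex1 that unfolding x_def using theI'[of "\<lambda>x. x \<in> closure U \<and> f (x, \<mu>) = x"] by blast
  obtain D :: "'e \<times> 'f \<Rightarrow> ('e \<times> 'f) \<Rightarrow>\<^sub>L 'e" where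
    D: "\<forall>p\<in>closure U \<times> \<Lambda>. Vector_Spaces.linear (module_prod.scale sE sF) sE (D p) \<and>
      (f has_derivative D p) (at p within closure U \<times> \<Lambda>)"
    and cont: "continuous_on (closure U \<times> \<Lambda>) D"
    using assms(8) unfolding continuously_differentiable_on_def by (elim exE conjE)
  note lin = bspec[OF D, THEN conjunct1]
    and deriv = bspec[OF D, THEN conjunct2]
  have contr: "norm (D (x \<mu>, \<mu>) (v, 0)) \<le> L * norm v" if "\<mu> \<in> \<Lambda>" for \<mu> v
    using partial_derivative_contraction[OF assms(3) that deriv cont assms(11)]
      x that by simp
  have "\<exists>T :: 'f \<Rightarrow>\<^sub>L 'e. \<forall>h. D (x \<mu>, \<mu>) (T h, h) = T h" if "\<mu> \<in> \<Lambda>" for \<mu>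
    using fixed_point_operator_exists[OF less_imp_le[OF assms(9)] assms(10) contr[OF that]]
    by metis
  then obtain T :: "'f \<Rightarrow> 'f \<Rightarrow>\<^sub>L 'e"
    where T: "\<And>\<mu> h. \<mu> \<in> \<Lambda> \<Longrightarrow> D (x \<mu>, \<mu>) (T \<mu> h, h) = T \<mu> h"
    by metis
  have T_deriv: "(x has_derivative T \<mu>) (at \<mu> within \<Lambda>)" if "\<mu> \<in> \<Lambda>" for \<mu>
    using fixed_point_has_derivative[OF assms(10) that x assms(11) deriv contr[OF that] T[OF that]]
      x that by simp
  have T_lin: "Vector_Spaces.linear sF sE (T \<mu>)" if "\<mu> \<in> \<Lambda>" for \<mu>
    using fixed_point_operator_linear[OF assms(1,2) lin assms(10) contr[OF that] T[OF that]]
      x that by simp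
  have "continuous_on \<Lambda> T"
    unfolding continuous_on_def
  proof
    fix \<mu> assume \<mu>: "\<mu> \<in> \<Lambda>"
    have "continuous_on \<Lambda> x"
      by (rule has_derivative_continuous_on) (rule T_deriv)
    then have "continuous_on \<Lambda> (\<lambda>\<nu>. D (x \<nu>, \<nu>))"
      by (intro continuous_on_compose2[OF cont continuous_on_Pair]) (use x in auto)
    then have "((\<lambda>\<nu>. D (x \<nu>, \<nu>)) \<longlongrightarrow> D (x \<mu>, \<mu>)) (at \<mu> within \<Lambda>)"
      using \<mu> by (simp add: continuous_on_def)
    then have "((\<lambda>\<nu>. (norm (T \<mu>) + 1) / (1 - L) * norm (D (x \<nu>, \<nu>) - D (x \<mu>, \<mu>))) \<longlongrightarrow> 0)
        (at \<mu> within \<Lambda>)"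
      by (intro tendsto_mult_right_zero tendsto_norm_zero LIM_zero)
    moreover have "\<forall>\<^sub>F \<nu> in at \<mu> within \<Lambda>. norm (T \<nu> - T \<mu>) \<le>
        (norm (T \<mu>) + 1) / (1 - L) * norm (D (x \<nu>, \<nu>) - D (x \<mu>, \<mu>))"
      unfolding eventually_at_filter
      using fixed_point_operator_stability[OF assms(10) contr T T[OF \<mu>]]
      by (intro always_eventually) simp
    ultimately show "(T \<longlongrightarrow> T \<mu>) (at \<mu> within \<Lambda>)"
      by (rule LIM_zero_cancel[OF Lim_null_comparison, rotated])
  qed
  then show "continuously_differentiable_on sF sE \<Lambda> (\<lambda>\<mu>. THE x. x \<in> closure U \<and> f (x, \<mu>) = x)"
    using T_deriv T_lin
    unfolding continuously_differentiable_on_def x_def[symmetric]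
    by (intro exI[of _ T]) simp
qed

end
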